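(* For all positive integers $n, r$ with $r \ge 2$, we have $$\widetilde{A}^+_{n,r}(t) = \sum_{i=0}^{\lfloor n/2 \rfloor} \widetilde{\gamma}^+_{n,r,i} \, t^i (1+t)^{n-2i}, \qquad \widetilde{A}^-_{n,r}(t) = \sum_{i=1}^{\lfloor (n+1)/2 \rfloor} \widetilde{\gamma}^-_{n,r,i} \, t^i (1+t)^{n+1-2i},$$ where $$\widetilde{\gamma}^+_{n,r,i} := \sum_{k=2i}^n \binom{n}{k} \xi^+_{k,r,i}, \qquad \widetilde{\gamma}^-_{n,r,i} := \sum_{k=2i}^n \binom{n}{k} \xi^-_{k,r,i}.$$ As a result: (i) $\widetilde{\gamma}^+_{n,r,i}$ is equal to the number of $w \in \mathbb{Z}_r \wr \mathfrak{S}_{n+1}$ for which $\mathrm{Asc}(w)$ has exactly $i+1$ elements, no two consecutive, and contains $n$, and $w(1) > w(2) > \cdots > w(m) = 1$ have all zero color, for some $m$; (ii) $\widetilde{\gamma}^-_{n,r,i}$ is equal to the number of $w \in \mathbb{Z}_r \wr \mathfrak{S}_{n+1}$ for which $\mathrm{Asc}(w) \subseteq \{1,\dots,n-1\}$ has exactly $i$ elements, no two consecutive, and $w(1) > w(2) > \cdots > w(m) = 1$ have all zero color, for some $m$.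
   Context: **Colored permutations.** Elements of $\mathbb{Z}_r \wr \mathfrak{S}_n$ are represented as pairs $w = (\sigma, \varepsilon)$ with $\sigma \in \mathfrak{S}_n$ and $\varepsilon \in \{0,1,\dots,r-1\}^n$, where $\varepsilon_k$ is the color of $\sigma(k)$. The condition "$w(1) > w(2) > \cdots > w(m) = 1$ have all zero color" means $\sigma(1) > \sigma(2) > \cdots > \sigma(m) = 1$ and $\varepsilon_1 = \cdots = \varepsilon_m = 0$. An index $k \in \{1,\dots,n\}$ is a descent of $w \in \mathbb{Z}_r \wr \mathfrak{S}_n$ if either $\varepsilon_k > \varepsilon_{k+1}$, or $\varepsilon_k = \varepsilon_{k+1}$ and $\sigma(k) > \sigma(k+1)$, where $\sigma(n+1) := n+1$ and $\varepsilon_{n+1} := 0$. The set of ascents $\mathrm{Asc}(w)$ is the complement in $\{1,\dots,n\}$ of the set of descents. **The numbers $\xi^{\pm}$.** For $n \ge 1$, $\xi^+_{n,r,i}$ is the number of $w \in \mathbb{Z}_r \wr \mathfrak{S}_n$ for which $\mathrm{Asc}(w) \subseteq \{2,\dots,n\}$ has exactly $i$ elements, no two consecutive, and contains $n$; $\xi^-_{n,r,i}$ is the number of $w \in \mathbb{Z}_r \wr \mathfrak{S}_n$ for which $\mathrm{Asc}(w) \subseteq \{2,\dots,n-1\}$ has exactly $i-1$ elements, no two consecutive. By convention $\xi^+_{0,r,0} = 1$, $\xi^+_{0,r,i}=0$ for $i\geq 1$, and $\xi^-_{0,r,i} = 0$. **The polynomials.** Set $d^+_{0,r}(t) = 1$,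 $d^-_{0,r}(t) = 0$ and, for $n \ge 1$, $$d^+_{n,r}(t) = \sum_{i=1}^{\lfloor n/2 \rfloor} \xi^+_{n,r,i}\, t^i(1+t)^{n-2i}, \qquad d^-_{n,r}(t) = \sum_{i=1}^{\lfloor (n+1)/2 \rfloor} \xi^-_{n,r,i}\, t^i(1+t)^{n+1-2i}.$$ (Their sum is the derangement polynomial of $\mathbb{Z}_r\wr\mathfrak{S}_n$, that is, the generating polynomial of the excedance number over colored permutations with no fixed point of zero color.) Then $$A^{\pm}_{n,r}(t) = \sum_{k=0}^n \binom{n}{k} d^{\pm}_{k,r}(t), \qquad \widetilde{A}^{\pm}_{n,r}(t) = \sum_{m=0}^n \binom{n}{m} t^{n-m} A^{\pm}_{m,r}(t).$$
   Formalization: False as printed (the second expansion fails at n=1; (i) and (ii) miscount); corrected here: the sum defining γ̃^- starts at k=2i-1 instead of 2i, in (i) Asc(w) contains n+1 instead of n, and in (ii) Asc(w) ⊆ {1,…,n} instead of {1,…,n-1}. *)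

theory Defs
  imports
    Complex_Main
    "HOL-Combinatorics.Permutations"
    "HOL-Computational_Algebra.Polynomial"
begin

type_synonym colored_perm = "(nat \<Rightarrow> nat) \<times> (nat \<Rightarrow> nat)"

text \<open>
  A pair \<open>(\<sigma>, \<epsilon>)\<close> stands for an element of the wreath product of the integers modulo \<open>r\<close>
  by the symmetric group on \<open>{1..n}\<close>; \<open>\<epsilon> k\<close> is the color of \<open>\<sigma> k\<close>.  Outside \<open>{1..n}\<close>
  the map \<open>\<sigma>\<close> is the identity and \<open>\<epsilon>\<close> is zero.  This makes the representation unique, and
  it builds in the conventions \<open>\<sigma> (n + 1) = n + 1\<close> and \<open>\<epsilon> (n + 1) = 0\<close> used by \<open>Des\<close>.
\<close>

definition colored_perms :: "nat \<Rightarrow> nat \<Rightarrow> colored_perm set" where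
  "colored_perms n r =
     {(\<sigma>, \<epsilon>). \<sigma> permutes {1..n} \<and> (\<forall>k\<in>{1..n}. \<epsilon> k < r) \<and> (\<forall>k. k \<notin> {1..n} \<longrightarrow> \<epsilon> k = 0)}"

definition Des :: "nat \<Rightarrow> colored_perm \<Rightarrow> nat set" where
  "Des n = (\<lambda>(\<sigma>, \<epsilon>). {k \<in> {1..n}.
     \<epsilon> k > \<epsilon> (k + 1) \<or> (\<epsilon> k = \<epsilon> (k + 1) \<and> \<sigma> k > \<sigma> (k + 1))})"

definition Asc :: "nat \<Rightarrow> colored_perm \<Rightarrow> nat set" where
  "Asc n w = {1..n} - Des n w"

definition no_two_consecutive :: "nat set \<Rightarrow> bool" where
  "no_two_consecutive S \<longleftrightarrow> (\<forall>k\<in>S. k + 1 \<notin> S)"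

definition xi_plus :: "nat \<Rightarrow> nat \<Rightarrow> nat \<Rightarrow> nat" where
  "xi_plus n r i =
     (if n = 0 then (if i = 0 then 1 else 0)
      else card {w \<in> colored_perms n r. Asc n w \<subseteq> {2..n} \<and> card (Asc n w) = i \<and>
                   no_two_consecutive (Asc n w) \<and> n \<in> Asc n w})"

text \<open>
  ``Exactly \<open>i - 1\<close> ascents'' is written \<open>card (Asc n w) + 1 = i\<close>, so that the value at
  \<open>i = 0\<close> is zero and not affected by truncated subtraction.
\<close>

definition xi_minus :: "nat \<Rightarrow> nat \<Rightarrow> nat \<Rightarrow> nat" where
  "xi_minus n r i =
     (if n = 0 then 0
      else card {w \<in> colored_perms n r. Asc n w \<subseteq> {2..n - 1} \<and> card (Asc n w) + 1 = i \<and>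
                   no_two_consecutive (Asc n w)})"

abbreviation tvar :: "int poly" where
  "tvar \<equiv> [:0, 1:]"

definition d_plus :: "nat \<Rightarrow> nat \<Rightarrow> int poly" where
  "d_plus n r =
     (if n = 0 then 1
      else (\<Sum>i = 1..n div 2. of_nat (xi_plus n r i) * tvar ^ i * (1 + tvar) ^ (n - 2 * i)))"

definition d_minus :: "nat \<Rightarrow> nat \<Rightarrow> int poly" where
  "d_minus n r =
     (if n = 0 then 0
      else (\<Sum>i = 1..(n + 1) div 2.
              of_nat (xi_minus n r i) * tvar ^ i * (1 + tvar) ^ (n + 1 - 2 * i)))"

definition A_plus :: "nat \<Rightarrow> nat \<Rightarrow> int poly" where
  "A_plus n r = (\<Sum>k = 0..n. of_nat (n choose k) * d_plus k r)"

definition A_minus :: "nat \<Rightarrow> nat \<Rightarrow> int poly" where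
  "A_minus n r = (\<Sum>k = 0..n. of_nat (n choose k) * d_minus k r)"

definition A_tilde_plus :: "nat \<Rightarrow> nat \<Rightarrow> int poly" where
  "A_tilde_plus n r = (\<Sum>m = 0..n. of_nat (n choose m) * tvar ^ (n - m) * A_plus m r)"

definition A_tilde_minus :: "nat \<Rightarrow> nat \<Rightarrow> int poly" where
  "A_tilde_minus n r = (\<Sum>m = 0..n. of_nat (n choose m) * tvar ^ (n - m) * A_minus m r)"

definition gamma_tilde_plus :: "nat \<Rightarrow> nat \<Rightarrow> nat \<Rightarrow> nat" where
  "gamma_tilde_plus n r i = (\<Sum>k = 2 * i..n. (n choose k) * xi_plus k r i)"

text \<open>
  The sum starts at \<open>k = 2 * i - 1\<close>, the least \<open>k\<close> for which \<open>xi_minus k r i\<close> can be nonzero.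
  The source prints the lower limit \<open>k = 2 * i\<close>, which drops a nonzero term: for example
  \<open>xi_minus 1 r 1 = r - 1\<close>, so the expansion of \<open>A_tilde_minus 1 r\<close>, which is \<open>r - 1\<close> times
  the indeterminate, would fail.
\<close>

definition gamma_tilde_minus :: "nat \<Rightarrow> nat \<Rightarrow> nat \<Rightarrow> nat" where
  "gamma_tilde_minus n r i = (\<Sum>k = 2 * i - 1..n. (n choose k) * xi_minus k r i)"

text \<open>\<open>w(1) > w(2) > \<dots> > w(m) = 1\<close> have all zero color, for some \<open>m\<close>.\<close>

definition zero_colored_descent_to_one :: "nat \<Rightarrow> colored_perm \<Rightarrow> bool" where
  "zero_colored_descent_to_one n = (\<lambda>(\<sigma>, \<epsilon>). \<exists>m\<in>{1..n}.
     (\<forall>k\<in>{1..<m}. \<sigma> k > \<sigma> (k + 1)) \<and> \<sigma> m = 1 \<and> (\<forall>k\<in>{1..m}. \<epsilon> k = 0))"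

text \<open>
  The two families counted by the \<open>\<gamma>\<close>-coefficients consist of colored permutations of
  \<open>{1..n + 1}\<close>.  The source prints ``contains \<open>n\<close>'' and \<open>{1..n - 1}\<close>; with ascent sets contained
  in \<open>{1..n + 1}\<close>, as here, the conditions have to read ``contains \<open>n + 1\<close>'' and \<open>{1..n}\<close>.
  For \<open>n = 1\<close>, \<open>i = 0\<close> there are \<open>r - 1\<close> elements satisfying the first printed condition, but
  \<open>gamma_tilde_plus 1 r 0 = 1\<close>.  For \<open>n = i = 1\<close> none satisfies the second, but
  \<open>gamma_tilde_minus 1 r 1 = r - 1\<close>.
\<close>

definition gamma_plus_family :: "nat \<Rightarrow> nat \<Rightarrow> nat \<Rightarrow> colored_perm set" where
  "gamma_plus_family n r i =
     {w \<in> colored_perms (n + 1) r.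
        card (Asc (n + 1) w) = i + 1 \<and> no_two_consecutive (Asc (n + 1) w) \<and>
        n + 1 \<in> Asc (n + 1) w \<and> zero_colored_descent_to_one (n + 1) w}"

definition gamma_minus_family :: "nat \<Rightarrow> nat \<Rightarrow> nat \<Rightarrow> colored_perm set" where
  "gamma_minus_family n r i =
     {w \<in> colored_perms (n + 1) r.
        Asc (n + 1) w \<subseteq> {1..n} \<and> card (Asc (n + 1) w) = i \<and>
        no_two_consecutive (Asc (n + 1) w) \<and> zero_colored_descent_to_one (n + 1) w}"

end

theory Submission
  imports Defs
begin

text \<open>
  Composing the two binomial sums gives \<open>A_tilde n = \<Sum>k. (n choose k) * (1 + t) ^ (n - k) * d k\<close>,
  into which the expansion of each \<open>d k\<close> can be substituted.

  For the counts, let \<open>w\<close> descend with color zero down to \<open>w(m) = 1\<close>, and put \<open>k = n + 1 - m\<close>.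
  Such a \<open>w\<close> is determined by the set \<open>S\<close> of its last \<open>k\<close> values, which is any \<open>k\<close>-subset of
  \<open>{2..n + 1}\<close>, and by the standardization \<open>v\<close> of its last \<open>k\<close> entries, which is any colored
  permutation of \<open>{1..k}\<close>.  Position \<open>m\<close> is always an ascent, so \<open>Asc w = {m} \<union> (m + Asc v)\<close>;
  having no two consecutive ascents then forces \<open>1 \<notin> Asc v\<close>, which is the condition in \<open>\<xi>\<close>.
\<close>

section \<open>Binomial transforms of gamma-expansions\<close>

lemma binomial_transform_twice:
  fixes x :: "'a::comm_semiring_1"
  shows "(\<Sum>m = 0..n. of_nat (n choose m) * x ^ (n - m) * (\<Sum>k = 0..m. of_nat (m choose k) * d k))
       = (\<Sum>k = 0..n. of_nat (n choose k) * (1 + x) ^ (n - k) * d k)"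
proof -
  have "(\<Sum>m = 0..n. of_nat (n choose m) * x ^ (n - m) * (\<Sum>k = 0..m. of_nat (m choose k) * d k))
      = (\<Sum>m\<in>{0..n}. \<Sum>k\<in>{k. k \<in> {0..n} \<and> k \<le> m}.
           of_nat ((n choose m) * (m choose k)) * x ^ (n - m) * d k)"
    by (intro sum.cong refl, unfold sum_distrib_left, intro sum.cong) (auto simp: ac_simps)
  also have "\<dots> = (\<Sum>k\<in>{0..n}. \<Sum>m\<in>{m. m \<in> {0..n} \<and> k \<le> m}.
           of_nat ((n choose m) * (m choose k)) * x ^ (n - m) * d k)"
    by (rule sum.swap_restrict) auto
  also have "\<dots> = (\<Sum>k = 0..n. of_nat (n choose k) * (1 + x) ^ (n - k) * d k)"
  proof (intro sum.cong refl)
    fix k assume k: "k \<in> {0..n}"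
    \<comment> \<open>Put \<open>m = j + k\<close>: since \<open>(n choose m) * (m choose k) = (n
      choose k) * (n - k choose m - k)\<close>, the inner sum is the binomial expansion of
      \<open>(1 + x) ^ (n - k)\<close>.\<close>
    have "(\<Sum>m\<in>{m. m \<in> {0..n} \<and> k \<le> m}.
             of_nat ((n choose m) * (m choose k)) * x ^ (n - m) * d k)
        = (\<Sum>j\<le>n - k. of_nat (n choose k) * (of_nat (n - k choose j) * 1 ^ j * x ^ (n - k - j)) * d k)"
      by (rule sum.reindex_bij_witness[of _ "\<lambda>j. j + k" "\<lambda>m. m - k"])
         (use k in \<open>auto simp: choose_mult simp flip: mult.assoc\<close>)
    also have "\<dots> = of_nat (n choose k) * (1 + x) ^ (n - k) * d k"
      by (simp only: sum_distrib_left sum_distrib_right binomial_ring)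
    finally show "(\<Sum>m\<in>{m. m \<in> {0..n} \<and> k \<le> m}.
             of_nat ((n choose m) * (m choose k)) * x ^ (n - m) * d k)
        = of_nat (n choose k) * (1 + x) ^ (n - k) * d k" .
  qed
  finally show ?thesis .
qed

text \<open>The product \<open>(1 + t) ^ (n - k) * (1 + t) ^ (k - a i)\<close> no longer depends on
  \<open>k\<close>, so only the coefficients are summed over \<open>k\<close>. The condition
  \<open>a i \<le> k\<close> keeps the subtraction exact. The offset \<open>a i\<close> is later
  \<open>2 * i\<close> or \<open>2 * i - 1\<close>.\<close>

lemma binomial_transform_gamma_expansion:
  fixes t :: "'a::comm_semiring_1" and c :: "nat \<Rightarrow> nat \<Rightarrow> nat"
  assumes "finite J"
  shows "(\<Sum>k = 0..n. of_nat (n choose k) * (1 + t) ^ (n - k) *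
            (\<Sum>i\<in>{i \<in> J. a i \<le> k}. of_nat (c k i) * t ^ i * (1 + t) ^ (k - a i)))
       = (\<Sum>i\<in>{i \<in> J. a i \<le> n}.
            of_nat (\<Sum>k = a i..n. (n choose k) * c k i) * t ^ i * (1 + t) ^ (n - a i))"
proof -
  have "(\<Sum>k = 0..n. of_nat (n choose k) * (1 + t) ^ (n - k) *
            (\<Sum>i\<in>{i \<in> J. a i \<le> k}. of_nat (c k i) * t ^ i * (1 + t) ^ (k - a i)))
      = (\<Sum>k\<in>{0..n}. \<Sum>i\<in>{i. i \<in> J \<and> a i \<le> k}.
            of_nat ((n choose k) * c k i) * t ^ i * ((1 + t) ^ (n - k) * (1 + t) ^ (k - a i)))"
    by (simp add: sum_distrib_left ac_simps)
  also have "\<dots> = (\<Sum>k\<in>{0..n}. \<Sum>i\<in>{i. i \<in> J \<and> a i \<le> k}.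
            of_nat ((n choose k) * c k i) * t ^ i * (1 + t) ^ (n - a i))"
    by (intro sum.cong refl) (auto simp flip: power_add)
  also have "\<dots> = (\<Sum>i\<in>J. \<Sum>k\<in>{k. k \<in> {0..n} \<and> a i \<le> k}.
            of_nat ((n choose k) * c k i) * t ^ i * (1 + t) ^ (n - a i))"
    by (rule sum.swap_restrict) (use assms in auto)
  also have "\<dots> = (\<Sum>i\<in>J. of_nat (\<Sum>k = a i..n. (n choose k) * c k i) * t ^ i * (1 + t) ^ (n - a i))"
    by (intro sum.cong refl, unfold of_nat_sum sum_distrib_right, intro sum.cong) auto
  \<comment> \<open>For \<open>a i > n\<close> the coefficient sum over \<open>{a i..n}\<close> is
    empty, so those indices drop out.\<close>
  also have "\<dots> = (\<Sum>i\<in>{i \<in> J. a i \<le> n}.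
            of_nat (\<Sum>k = a i..n. (n choose k) * c k i) * t ^ i * (1 + t) ^ (n - a i))"
    by (intro sum.mono_neutral_right) (use assms in auto)
  finally show ?thesis .
qed

section \<open>Ascent sets, values at \<open>i = 0\<close>, and the two polynomial
  expansions\<close>

lemma Asc_subset: "Asc n w \<subseteq> {1..n}"
  by (auto simp: Asc_def)

lemma finite_Asc [simp]: "finite (Asc n w)"
  using Asc_subset finite_subset by blast

lemma mem_Asc:
  "j \<in> Asc n (\<sigma>, \<epsilon>) \<longleftrightarrow> j \<in> {1..n} \<and> \<not> (\<epsilon> j > \<epsilon> (j + 1) \<or> (\<epsilon> j = \<epsilon> (j + 1) \<and> \<sigma> j > \<sigma> (j + 1)))"
  by (auto simp: Asc_def Des_def)

lemma xi_plus_0: "xi_plus k r 0 = (if k = 0 then 1 else 0)"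
  by (auto simp: xi_plus_def card_eq_0_iff)

lemma xi_minus_0: "xi_minus k r 0 = 0"
  by (auto simp: xi_minus_def)

text \<open>Admitting \<open>i = 0\<close> absorbs the special case: for \<open>k > 0\<close> that
  term is zero because the ascent set must contain \<open>k\<close>, and for \<open>k = 0\<close> it
  is the prescribed 1.\<close>

lemma d_plus_altdef:
  "d_plus k r = (\<Sum>i\<in>{0..k div 2}. of_nat (xi_plus k r i) * tvar ^ i * (1 + tvar) ^ (k - 2 * i))"
  by (cases "k = 0") (simp_all add: d_plus_def xi_plus_0 sum.atLeast_Suc_atMost)

lemma d_minus_altdef:
  "d_minus k r = (\<Sum>i\<in>{1..(k + 1) div 2}. of_nat (xi_minus k r i) * tvar ^ i * (1 + tvar) ^ (k + 1 - 2 * i))"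
  by (cases "k = 0") (simp_all add: d_minus_def)

lemma A_tilde_plus_expansion:
  "A_tilde_plus n r =
     (\<Sum>i = 0..n div 2. of_nat (gamma_tilde_plus n r i) * tvar ^ i * (1 + tvar) ^ (n - 2 * i))"
proof -
  \<comment> \<open>The range of \<open>i\<close> depending on \<open>k\<close> becomes a filter on
    one fixed index set, the form in which the two sums can be exchanged.\<close>
  have eq: "{0..k div 2} = {i \<in> {0..n}. 2 * i \<le> k}" if "k \<le> n" for k
    using that by auto
  have "A_tilde_plus n r = (\<Sum>k = 0..n. of_nat (n choose k) * (1 + tvar) ^ (n - k) * d_plus k r)"
    unfolding A_tilde_plus_def A_plus_def by (rule binomial_transform_twice)
  also have "\<dots> = (\<Sum>k = 0..n. of_nat (n choose k) * (1 + tvar) ^ (n - k) *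
      (\<Sum>i\<in>{i \<in> {0..n}. 2 * i \<le> k}. of_nat (xi_plus k r i) * tvar ^ i * (1 + tvar) ^ (k - 2 * i)))"
    by (intro sum.cong refl) (simp add: d_plus_altdef eq)
  also have "\<dots> = (\<Sum>i\<in>{i \<in> {0..n}. 2 * i \<le> n}.
      of_nat (gamma_tilde_plus n r i) * tvar ^ i * (1 + tvar) ^ (n - 2 * i))"
    unfolding gamma_tilde_plus_def by (rule binomial_transform_gamma_expansion) simp
  finally show ?thesis
    by (simp only: eq[OF order_refl])
qed

lemma A_tilde_minus_expansion:
  "A_tilde_minus n r =
     (\<Sum>i = 1..(n + 1) div 2. of_nat (gamma_tilde_minus n r i) * tvar ^ i * (1 + tvar) ^ (n + 1 - 2 * i))"
proof -
  have eq: "{1..(k + 1) div 2} = {i \<in> {1..n}. 2 * i - 1 \<le> k}" if "k \<le> n" for k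
    using that by auto
  \<comment> \<open>At \<open>i = 0\<close> truncated subtraction would break this identity
    (\<open>k + 1\<close> against \<open>k\<close>); the range starts at 1.\<close>
  have ex: "k + 1 - 2 * i = k - (2 * i - 1)" if "i \<in> {1..(k + 1) div 2}" for k i :: nat
    using that by auto
  have d: "d_minus k r = (\<Sum>i\<in>{i \<in> {1..n}. 2 * i - 1 \<le> k}.
         of_nat (xi_minus k r i) * tvar ^ i * (1 + tvar) ^ (k - (2 * i - 1)))" if "k \<le> n" for k
    unfolding eq[OF that, symmetric] d_minus_altdef by (rule sum.cong[OF refl], subst ex) auto
  have "A_tilde_minus n r = (\<Sum>k = 0..n. of_nat (n choose k) * (1 + tvar) ^ (n - k) * d_minus k r)"
    unfolding A_tilde_minus_def A_minus_def by (rule binomial_transform_twice)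
  also have "\<dots> = (\<Sum>k = 0..n. of_nat (n choose k) * (1 + tvar) ^ (n - k) *
      (\<Sum>i\<in>{i \<in> {1..n}. 2 * i - 1 \<le> k}.
         of_nat (xi_minus k r i) * tvar ^ i * (1 + tvar) ^ (k - (2 * i - 1))))"
    by (intro sum.cong refl) (simp add: d)
  also have "\<dots> = (\<Sum>i\<in>{i \<in> {1..n}. 2 * i - 1 \<le> n}.
      of_nat (gamma_tilde_minus n r i) * tvar ^ i * (1 + tvar) ^ (n - (2 * i - 1)))"
    unfolding gamma_tilde_minus_def by (rule binomial_transform_gamma_expansion) simp
  also have "\<dots> = (\<Sum>i = 1..(n + 1) div 2.
      of_nat (gamma_tilde_minus n r i) * tvar ^ i * (1 + tvar) ^ (n + 1 - 2 * i))"
    unfolding eq[OF order_refl, symmetric]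
    by (rule sum.cong[OF refl], subst ex) auto
  finally show ?thesis .
qed

section \<open>Decreasing sequences and shuffles\<close>

text \<open>By strong induction: all earlier values agree, so \<open>f j\<close> can occur in
  \<open>g\<close> only at position \<open>j\<close> or later, which gives
  \<open>f j \<le> g j\<close>; the converse is symmetric.\<close>

lemma strict_antimono_on_image_eqD:
  fixes f g :: "nat \<Rightarrow> 'a::linorder"
  assumes f: "strict_antimono_on {a..b} f" and g: "strict_antimono_on {a..b} g"
    and im: "f ` {a..b} = g ` {a..b}" and j: "j \<in> {a..b}"
  shows "f j = g j"
  using j
proof (induction j rule: less_induct)
  case (less j)
  obtain i where i: "i \<in> {a..b}" "f j = g i"
    using im less.prems by (metis imageE imageI)
  obtain i' where i': "i' \<in> {a..b}" "g j = f i'"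
    using im less.prems by (metis imageE imageI)
  have "i \<ge> j"
    using less i f by (metis monotone_onD not_less_iff_gr_or_eq linorder_not_less)
  hence "f j \<le> g j"
    using i less.prems g by (metis monotone_onD order.order_iff_strict)
  have "i' \<ge> j"
    using less i' g by (metis monotone_onD not_less_iff_gr_or_eq linorder_not_less)
  hence "g j \<le> f j"
    using i' less.prems f by (metis monotone_onD order.order_iff_strict)
  with \<open>f j \<le> g j\<close> show ?case by simp
qed

lemma strict_antimono_on_consecutive:
  fixes f :: "nat \<Rightarrow> 'a::order"
  assumes "\<And>j. j \<in> {a..<b} \<Longrightarrow> f j > f (j + 1)"
  shows "strict_antimono_on {a..b} f"
proof (rule monotone_onI)
  fix x y assume "x \<in> {a..b}" "y \<in> {a..b}" "x < y"
  from \<open>x < y\<close> \<open>y \<in> {a..b}\<close> show "f y < f x"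
  proof (induction y)
    case (Suc y)
    with assms[of y] \<open>x \<in> {a..b}\<close> show ?case
      by (cases "x = y") auto
  qed simp
qed

text \<open>Canonical representative of the permutations that decrease on the first \<open>m\<close>
  positions and send the last \<open>k\<close> positions onto \<open>S\<close>: each of them is
  \<open>p\<close> precomposed with a permutation of the last \<open>k\<close> positions.\<close>

definition shuffle :: "nat \<Rightarrow> nat \<Rightarrow> nat set \<Rightarrow> (nat \<Rightarrow> nat) \<Rightarrow> bool" where
  "shuffle m k S p \<longleftrightarrow> p permutes {1..m + k} \<and> p ` {m + 1..m + k} = S \<and>
     strict_antimono_on {1..m} p \<and> strict_mono_on {m + 1..m + k} p"

lemma exists_shuffle:
  assumes S: "S \<subseteq> {1..m + k}" and card: "card S = k"
  shows "\<exists>p. shuffle m k S p"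
proof -
  \<comment> \<open>The one-line notation will be \<open>D @ U\<close>: the complement of
    \<open>S\<close> decreasingly, then \<open>S\<close> increasingly. The index
    \<open>j - 1\<close> in \<open>p\<close> converts positions starting at 1 to list indices
    starting at 0.\<close>
  define D where "D = rev (sorted_list_of_set ({1..m + k} - S))"
  define U where "U = sorted_list_of_set S"
  define p where "p j = (if j \<in> {1..m + k} then (D @ U) ! (j - 1) else j)" for j
  have fin: "finite S" using S finite_subset by blast
  have len: "length D = m" "length U = k"
    using S card fin by (auto simp: D_def U_def card_Diff_subset)
  have set: "set U = S" "set (D @ U) = {1..m + k}"
    using S fin by (auto simp: D_def U_def)
  have "distinct (D @ U)"
    using fin by (auto simp: D_def U_def)
  hence "bij_betw ((!) (D @ U)) {..<m + k} {1..m + k}"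
    by (intro bij_betw_nth) (use len set in auto)
  moreover have "bij_betw (\<lambda>j. j - 1) {1..m + k} {..<m + k}"
    by (rule bij_betwI[where g = Suc]) auto
  ultimately have "bij_betw ((!) (D @ U) \<circ> (\<lambda>j. j - 1)) {1..m + k} {1..m + k}"
    by (rule bij_betw_trans[rotated])
  hence "bij_betw p {1..m + k} {1..m + k}"
    by (rule bij_betw_cong[THEN iffD1, rotated]) (simp add: p_def)
  hence "p permutes {1..m + k}"
    by (rule bij_imp_permutes) (auto simp: p_def)
  moreover have "p ` {m + 1..m + k} = S"
  proof -
    have "bij_betw (\<lambda>j. j - Suc m) {m + 1..m + k} {..<k}"
      by (rule bij_betwI[where g = "\<lambda>j. j + Suc m"]) auto
    hence "(\<lambda>j. U ! (j - Suc m)) ` {m + 1..m + k} = (!) U ` {..<k}"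
      by (metis bij_betw_imp_surj_on image_image)
    moreover have "p j = U ! (j - Suc m)" if "j \<in> {m + 1..m + k}" for j
      using that len by (auto simp: p_def nth_append)
    ultimately have "p ` {m + 1..m + k} = (!) U ` {..<k}"
      by (metis (no_types, lifting) image_cong)
    thus ?thesis using set len by (auto simp: set_conv_nth)
  qed
  moreover have "strict_antimono_on {1..m} p"
  proof (rule monotone_onI)
    fix x y assume xy: "x \<in> {1..m}" "y \<in> {1..m}" "x < y"
    have "sorted_wrt (>) D"
      by (simp add: D_def sorted_wrt_rev)
    from sorted_wrt_nth_less[OF this, of "x - 1" "y - 1"] show "p y < p x"
      using xy len by (auto simp: p_def nth_append)
  qed
  moreover have "strict_mono_on {m + 1..m + k} p"
  proof (rule monotone_onI)
    fix x y assume xy: "x \<in> {m + 1..m + k}" "y \<in> {m + 1..m + k}" "x < y"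
    have "sorted_wrt (<) U"
      by (simp add: U_def)
    from sorted_wrt_nth_less[OF this, of "x - 1 - m" "y - 1 - m"] show "p x < p y"
      using xy len by (auto simp: p_def nth_append)
  qed
  ultimately show ?thesis unfolding shuffle_def by blast
qed

section \<open>Gluing an initial descent to a colored permutation\<close>

text \<open>The condition \<open>zero_colored_descent_to_one\<close> with the position of the value
  1 fixed, so that the count can be split by \<open>m\<close>.\<close>

definition zero_colored_descent_at :: "nat \<Rightarrow> colored_perm \<Rightarrow> bool" where
  "zero_colored_descent_at m = (\<lambda>(\<sigma>, \<epsilon>).
     (\<forall>k\<in>{1..<m}. \<sigma> k > \<sigma> (k + 1)) \<and> \<sigma> m = 1 \<and> (\<forall>k\<in>{1..m}. \<epsilon> k = 0))"

definition shift_perm :: "nat \<Rightarrow> nat \<Rightarrow> (nat \<Rightarrow> nat) \<Rightarrow> nat \<Rightarrow> nat" where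
  "shift_perm m k = map_permutation {1..k} ((+) m)"

lemma shift_perm_permutes:
  "\<tau> permutes {1..k} \<Longrightarrow> shift_perm m k \<tau> permutes {m + 1..m + k}"
  unfolding shift_perm_def
  by (rule map_permutation_permutes) (auto simp: bij_betw_def)

lemma shift_perm_apply: "j \<in> {1..k} \<Longrightarrow> shift_perm m k \<tau> (m + j) = m + \<tau> j"
  unfolding shift_perm_def by (rule map_permutation_apply) auto

lemma bij_betw_shift_perm:
  "bij_betw (shift_perm m k) {\<tau>. \<tau> permutes {1..k}} {\<pi>. \<pi> permutes {m + 1..m + k}}"
proof (rule bij_betw_byWitness[where f' = "map_permutation {m + 1..m + k} (\<lambda>j. j - m)"])
  have bij: "bij_betw (\<lambda>j. j - m) {m + 1..m + k} {1..k}"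
    by (rule bij_betwI[where g = "(+) m"]) auto
  show "\<forall>\<tau>\<in>{\<tau>. \<tau> permutes {1..k}}.
          map_permutation {m + 1..m + k} (\<lambda>j. j - m) (shift_perm m k \<tau>) = \<tau>"
    unfolding shift_perm_def by (auto intro!: map_permutation_compose_inv simp: bij_betw_def)
  show "\<forall>\<pi>\<in>{\<pi>. \<pi> permutes {m + 1..m + k}}.
          shift_perm m k (map_permutation {m + 1..m + k} (\<lambda>j. j - m) \<pi>) = \<pi>"
    unfolding shift_perm_def using bij by (auto intro!: map_permutation_compose_inv)
  show "shift_perm m k ` {\<tau>. \<tau> permutes {1..k}} \<subseteq> {\<pi>. \<pi> permutes {m + 1..m + k}}"
    using shift_perm_permutes by blast
  show "map_permutation {m + 1..m + k} (\<lambda>j. j - m) ` {\<pi>. \<pi> permutes {m + 1..m + k}}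
      \<subseteq> {\<tau>. \<tau> permutes {1..k}}"
    using map_permutation_permutes[OF bij] by blast
qed

text \<open>Inverse of standardizing the last \<open>k\<close> entries: \<open>p\<close> supplies
  the initial descent and the value set of the tail. For \<open>j \<le> m\<close> truncated
  subtraction yields \<open>\<delta> 0\<close>, which is 0 for a colored permutation, so the first
  \<open>m\<close> entries have color zero.\<close>

definition graft :: "nat \<Rightarrow> nat \<Rightarrow> (nat \<Rightarrow> nat) \<Rightarrow> colored_perm \<Rightarrow> colored_perm" where
  "graft m k p = (\<lambda>(\<tau>, \<delta>). (p \<circ> shift_perm m k \<tau>, \<lambda>j. \<delta> (j - m)))"

lemma shift_perm_apply_low:
  "\<tau> permutes {1..k} \<Longrightarrow> j \<le> m \<Longrightarrow> shift_perm m k \<tau> j = j"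
  by (rule permutes_not_in[OF shift_perm_permutes]) auto

lemma shuffle_descent:
  "shuffle m k S p \<Longrightarrow> i \<in> {1..m} \<Longrightarrow> j \<in> {1..m} \<Longrightarrow> i < j \<Longrightarrow> p j < p i"
  unfolding shuffle_def by (blast dest: monotone_onD)

lemma shuffle_ascent:
  "shuffle m k S p \<Longrightarrow> i \<in> {m + 1..m + k} \<Longrightarrow> j \<in> {m + 1..m + k} \<Longrightarrow> i < j \<Longrightarrow> p i < p j"
  unfolding shuffle_def by (blast dest: monotone_onD)

text \<open>As \<open>1 \<notin> S\<close>, the value 1 is taken at one of the first
  \<open>m\<close> positions; \<open>p\<close> decreases there, so the least value comes
  last.\<close>

lemma shuffle_apply_one:
  assumes "shuffle m k S p" "m \<ge> 1" "1 \<notin> S"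
  shows "p m = 1"
proof -
  have p: "p permutes {1..m + k}" using assms by (simp add: shuffle_def)
  have "1 \<in> p ` {1..m + k}" using permutes_image[OF p] assms by simp
  then obtain j where j: "j \<in> {1..m + k}" "p j = 1" by auto
  have "j \<notin> {m + 1..m + k}"
    using assms j by (metis imageI shuffle_def)
  hence "j \<in> {1..m}" using j by auto
  moreover have "p m \<ge> 1" using permutes_in_image[OF p, of m] assms by simp
  ultimately show ?thesis
    using j assms shuffle_descent[of m k S p j m] by (cases "j = m") auto
qed

lemma zero_colored_descent_at_graft:
  assumes "shuffle m k S p" "m \<ge> 1" "1 \<notin> S" "v \<in> colored_perms k r"
  shows "zero_colored_descent_at m (graft m k p v)"
proof -
  obtain \<tau> \<delta> where v: "v = (\<tau>, \<delta>)" by force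
  have \<tau>: "\<tau> permutes {1..k}" and \<delta>: "\<delta> 0 = 0"
    using assms v by (auto simp: colored_perms_def)
  have "p (j + 1) < p j" if "j \<in> {1..<m}" for j
    using shuffle_descent[OF assms(1), of j "j + 1"] that by simp
  thus ?thesis
    using \<tau> \<delta> shuffle_apply_one[OF assms(1-3)]
    by (simp add: v zero_colored_descent_at_def graft_def shift_perm_apply_low)
qed

lemma graft_in_colored_perms:
  assumes "shuffle m k S p" "m \<ge> 1" "v \<in> colored_perms k r" "r \<ge> 1"
  shows "graft m k p v \<in> colored_perms (m + k) r"
proof -
  obtain \<tau> \<delta> where v: "v = (\<tau>, \<delta>)" by force
  have \<tau>: "\<tau> permutes {1..k}" and \<delta>: "\<And>j. j \<in> {1..k} \<Longrightarrow> \<delta> j < r" "\<And>j. j \<notin> {1..k} \<Longrightarrow> \<delta> j = 0"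
    using assms v by (auto simp: colored_perms_def)
  have "shift_perm m k \<tau> permutes {1..m + k}"
    by (rule permutes_subset[OF shift_perm_permutes[OF \<tau>]]) auto
  hence "p \<circ> shift_perm m k \<tau> permutes {1..m + k}"
    using assms by (intro permutes_compose) (auto simp: shuffle_def)
  \<comment> \<open>Outside \<open>{1..k}\<close> the color is the default 0, which is below
    \<open>r\<close> because \<open>r \<ge> 1\<close>.\<close>
  moreover have "\<delta> (j - m) < r" for j
    using \<delta>[of "j - m"] \<open>r \<ge> 1\<close> by (cases "j - m \<in> {1..k}") auto
  moreover have "\<delta> (j - m) = 0" if "j \<notin> {1..m + k}" for j
    using that by (intro \<delta>) auto
  ultimately show ?thesis
    by (simp add: v graft_def colored_perms_def)
qed

text \<open>Positions before \<open>m\<close> descend with \<open>p\<close>. Position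
  \<open>m\<close> holds the value 1 in color zero, which no following entry can undercut. After
  \<open>m\<close> the shuffle is increasing, so comparing entries amounts to comparing those of
  \<open>v\<close>.\<close>

lemma Asc_graft:
  assumes sh: "shuffle m k S p" and m: "m \<ge> 1" and S: "1 \<notin> S" and v: "v \<in> colored_perms k r"
  shows "Asc (m + k) (graft m k p v) = insert m ((+) m ` Asc k v)"
proof -
  obtain \<tau> \<delta> where v_eq: "v = (\<tau>, \<delta>)" by force
  have \<tau>: "\<tau> permutes {1..k}" and \<delta>: "\<And>j. j \<notin> {1..k} \<Longrightarrow> \<delta> j = 0"
    using v v_eq by (auto simp: colored_perms_def)
  have p: "p permutes {1..m + k}" using sh by (simp add: shuffle_def)
  define \<sigma> where "\<sigma> = p \<circ> shift_perm m k \<tau>"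
  have low: "\<sigma> j = p j" if "j \<le> m" for j
    using that \<tau> by (simp add: \<sigma>_def shift_perm_apply_low)
  \<comment> \<open>The index \<open>k + 1\<close> is included because the last position of
    \<open>v\<close> is compared with the conventional entry at \<open>k + 1\<close>, which
    corresponds to \<open>m + k + 1\<close> here.\<close>
  have high: "\<sigma> (m + j) = p (m + \<tau> j)" if "j \<in> {1..k + 1}" for j
  proof (cases "j \<in> {1..k}")
    case True
    thus ?thesis by (simp add: \<sigma>_def shift_perm_apply)
  next
    case False
    thus ?thesis
      using permutes_not_in[OF \<tau>, of j] permutes_not_in[OF shift_perm_permutes[OF \<tau>, of m], of "m + j"]
      by (simp add: \<sigma>_def)
  qed
  \<comment> \<open>The fixed point \<open>m + k + 1\<close> exceeds all values on the tail block,
    so monotonicity extends by one place.\<close>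
  have mono: "strict_mono_on {m + 1..m + k + 1} p"
  proof (rule monotone_onI)
    fix x y assume xy: "x \<in> {m + 1..m + k + 1}" "y \<in> {m + 1..m + k + 1}" "x < y"
    have "p x \<le> m + k" using xy permutes_in_image[OF p, of x] by auto
    thus "p x < p y"
      using xy permutes_not_in[OF p, of y] shuffle_ascent[OF sh, of x y]
      by (cases "y = m + k + 1") auto
  qed
  have range: "\<tau> j \<in> {1..k + 1}" if "j \<in> {1..k + 1}" for j
    using that permutes_in_image[OF \<tau>, of j] permutes_not_in[OF \<tau>, of j]
    by (cases "j \<in> {1..k}") auto
  have cmp: "\<sigma> (m + j) > \<sigma> (m + (j + 1)) \<longleftrightarrow> \<tau> j > \<tau> (j + 1)" if "j \<in> {1..k}" for j
    using that range[of j] range[of "j + 1"] mono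
    by (subst (1 2) high) (auto simp: strict_mono_on_less)
  have one: "\<sigma> m = 1" using shuffle_apply_one[OF sh m S] by (simp add: low)
  have "x \<in> Asc (m + k) (\<sigma>, \<lambda>j. \<delta> (j - m)) \<longleftrightarrow> x \<in> insert m ((+) m ` Asc k (\<tau>, \<delta>))" for x
  proof (cases x m rule: linorder_cases)
    case less
    have "x \<notin> Asc (m + k) (\<sigma>, \<lambda>j. \<delta> (j - m))"
      using less shuffle_descent[OF sh, of x "x + 1"] by (cases "x = 0") (auto simp: mem_Asc low)
    with less show ?thesis by auto
  next
    case equal
    have "\<sigma> permutes {1..m + k}"
      unfolding \<sigma>_def
      by (intro permutes_compose p permutes_subset[OF shift_perm_permutes[OF \<tau>]]) auto
    \<comment> \<open>If \<open>k = 0\<close>, position \<open>m + 1\<close> is outside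
      \<open>{1..m + k}\<close> and is a fixed point, so the bound holds there too.\<close>
    hence "\<sigma> (m + 1) \<ge> 1"
      by (metis permutes_in_image permutes_not_in atLeastAtMost_iff le_add2)
    thus ?thesis using equal m \<delta>[of 0] one by (auto simp: mem_Asc)
  next
    case greater
    then obtain j where x: "x = m + j" "j \<ge> 1"
      by (metis less_imp_add_positive One_nat_def Suc_leI)
    show ?thesis
    proof (cases "j \<in> {1..k}")
      case True
      have "x \<in> Asc (m + k) (\<sigma>, \<lambda>j. \<delta> (j - m)) \<longleftrightarrow> j \<in> Asc k (\<tau>, \<delta>)"
        using True cmp[OF True] by (simp add: mem_Asc x)
      thus ?thesis using x by auto
    next
      case False
      thus ?thesis using x by (auto simp: mem_Asc)
    qed
  qed
  thus ?thesis by (auto simp: v_eq graft_def \<sigma>_def)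
qed

text \<open>The ingredients can be read off: \<open>S\<close> is the value set of the last
  \<open>k\<close> positions, then the injective \<open>P S\<close> is known and cancels, and the
  tail colors are those of \<open>v\<close>.\<close>

lemma inj_on_graft:
  assumes "\<And>S. S \<in> \<S> \<Longrightarrow> shuffle m k S (P S)"
  shows "inj_on (\<lambda>(S, v). graft m k (P S) v) (\<S> \<times> colored_perms k r)"
proof (rule inj_onI)
  fix x y
  assume x: "x \<in> \<S> \<times> colored_perms k r" and y: "y \<in> \<S> \<times> colored_perms k r"
    and fxy: "(\<lambda>(S, v). graft m k (P S) v) x = (\<lambda>(S, v). graft m k (P S) v) y"
  obtain S \<tau> \<delta> S' \<tau>' \<delta>' where xy: "x = (S, \<tau>, \<delta>)" "y = (S', \<tau>', \<delta>')"
    by (metis prod_cases3)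
  have S: "S \<in> \<S>" "S' \<in> \<S>"
    and v: "(\<tau>, \<delta>) \<in> colored_perms k r" "(\<tau>', \<delta>') \<in> colored_perms k r"
    and eq: "graft m k (P S) (\<tau>, \<delta>) = graft m k (P S') (\<tau>', \<delta>')"
    using x y fxy by (auto simp: xy)
  have \<tau>: "\<tau> permutes {1..k}" "\<tau>' permutes {1..k}"
    using v by (auto simp: colored_perms_def)
  have eq1: "P S \<circ> shift_perm m k \<tau> = P S' \<circ> shift_perm m k \<tau>'"
    and eq2: "\<And>j. \<delta> (j - m) = \<delta>' (j - m)"
    using eq by (auto simp: graft_def fun_eq_iff)
  have img: "(P T \<circ> shift_perm m k \<rho>) ` {m + 1..m + k} = T" if "T \<in> \<S>" "\<rho> permutes {1..k}" for T \<rho>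
    unfolding image_comp[symmetric] permutes_image[OF shift_perm_permutes[OF that(2)]]
    using assms[OF that(1)] by (simp add: shuffle_def)
  have "S = S'"
    using img[OF S(1) \<tau>(1)] img[OF S(2) \<tau>(2)] eq1 by simp
  moreover have "inj (P S)"
    using assms[OF S(1)] permutes_inj by (auto simp: shuffle_def)
  ultimately have "shift_perm m k \<tau> = shift_perm m k \<tau>'"
    using eq1 by (metis fun.inj_map injD)
  hence "\<tau> = \<tau>'"
    using bij_betw_shift_perm[of m k] \<tau> by (auto simp: bij_betw_def inj_on_def)
  \<comment> \<open>Every index has the form \<open>(j + m) - m\<close>, so truncation loses
    nothing.\<close>
  moreover have "\<delta> = \<delta>'"
    using eq2 by (metis ext add_diff_cancel_right')
  ultimately show "x = y"
    using \<open>S = S'\<close> by (simp add: xy)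
qed

text \<open>The tail values give \<open>S\<close>. Both \<open>\<sigma>\<close> and the shuffle list
  the complement of \<open>S\<close> decreasingly on the first \<open>m\<close> positions, so they
  agree there; hence \<open>inv p \<circ> \<sigma>\<close> moves only the last \<open>k\<close>
  positions and is the shift of the sought \<open>\<tau>\<close>.\<close>

lemma graft_surj:
  assumes w: "w \<in> colored_perms (m + k) r" "zero_colored_descent_at m w" and m: "m \<ge> 1"
    and P: "\<And>S. S \<subseteq> {2..m + k} \<Longrightarrow> card S = k \<Longrightarrow> shuffle m k S (P S)"
  shows "\<exists>S v. S \<subseteq> {2..m + k} \<and> card S = k \<and> v \<in> colored_perms k r \<and> w = graft m k (P S) v"
proof -
  obtain \<sigma> \<epsilon> where w_eq: "w = (\<sigma>, \<epsilon>)" by force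
  have \<sigma>: "\<sigma> permutes {1..m + k}"
    and \<epsilon>: "\<And>j. j \<in> {1..m + k} \<Longrightarrow> \<epsilon> j < r" "\<And>j. j \<notin> {1..m + k} \<Longrightarrow> \<epsilon> j = 0"
    and desc: "\<And>j. j \<in> {1..<m} \<Longrightarrow> \<sigma> j > \<sigma> (j + 1)"
    and \<sigma>m: "\<sigma> m = 1" and \<epsilon>0: "\<And>j. j \<in> {1..m} \<Longrightarrow> \<epsilon> j = 0"
    using w by (auto simp: w_eq colored_perms_def zero_colored_descent_at_def)
  have inj: "inj \<sigma>" using \<sigma> permutes_inj by blast
  define S where "S = \<sigma> ` {m + 1..m + k}"
  have "S \<subseteq> {1..m + k}"
    unfolding S_def using permutes_image[OF \<sigma>] by (metis image_mono atLeastatMost_subset_iff le_add2 order_refl)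
  moreover have "1 \<notin> S"
  proof
    assume "1 \<in> S"
    then obtain x where "x \<in> {m + 1..m + k}" "\<sigma> x = \<sigma> m" by (auto simp: S_def \<sigma>m)
    thus False using injD[OF inj, of x m] by auto
  qed
  ultimately have S: "S \<subseteq> {2..m + k}"
  proof -
    have "x \<in> {2..m + k}" if "x \<in> {1..m + k}" "x \<noteq> 1" for x
      using that by auto
    thus ?thesis using \<open>S \<subseteq> {1..m + k}\<close> \<open>1 \<notin> S\<close> by blast
  qed
  have card: "card S = k"
    unfolding S_def by (subst card_image) (use inj inj_on_subset in auto)
  define p where "p = P S"
  have sh: "shuffle m k S p" unfolding p_def by (rule P[OF S card])
  have p: "p permutes {1..m + k}" using sh by (simp add: shuffle_def)
  have split: "{1..m} = {1..m + k} - {m + 1..m + k}" by auto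
  have "\<sigma> ` {1..m} = {1..m + k} - S"
    unfolding split S_def using permutes_image[OF \<sigma>] inj by (simp add: image_set_diff)
  moreover have "p ` {1..m} = {1..m + k} - S"
    unfolding split using permutes_image[OF p] permutes_inj[OF p] sh
    by (simp add: image_set_diff shuffle_def)
  ultimately have agree: "\<sigma> j = p j" if "j \<in> {1..m}" for j
    using that sh strict_antimono_on_consecutive[of 1 m \<sigma>] desc
    by (intro strict_antimono_on_image_eqD[of 1 m]) (auto simp: shuffle_def)
  have "inv p \<circ> \<sigma> permutes {1..m + k}"
    by (intro permutes_compose \<sigma> permutes_inv p)
  hence "inv p \<circ> \<sigma> permutes {m + 1..m + k}"
    by (rule permutes_superset) (use agree permutes_inverses(2)[OF p] in \<open>auto simp: split\<close>)
  then obtain \<tau> where \<tau>: "\<tau> permutes {1..k}" "shift_perm m k \<tau> = inv p \<circ> \<sigma>"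
    using bij_betw_shift_perm[of m k] unfolding bij_betw_def by (metis (no_types, lifting) imageE mem_Collect_eq)
  \<comment> \<open>At \<open>j = 0\<close> this reads the color at \<open>m\<close>, which is zero,
    as required outside \<open>{1..k}\<close>.\<close>
  define \<delta> where "\<delta> j = \<epsilon> (j + m)" for j
  have "p \<circ> shift_perm m k \<tau> = \<sigma>"
    by (simp add: \<tau> fun_eq_iff permutes_inverses[OF p])
  moreover have "(\<lambda>j. \<delta> (j - m)) = \<epsilon>"
  proof
    fix j show "\<delta> (j - m) = \<epsilon> j"
      using \<epsilon>0[of j] \<epsilon>0[of m] \<epsilon>(2)[of j] m by (cases "m \<le> j"; cases "j = 0") (auto simp: \<delta>_def)
  qed
  ultimately have "w = graft m k (P S) (\<tau>, \<delta>)"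
    by (simp add: graft_def w_eq p_def)
  moreover have "(\<tau>, \<delta>) \<in> colored_perms k r"
  proof -
    have "\<delta> j < r" if "j \<in> {1..k}" for j
      using that by (auto simp: \<delta>_def intro!: \<epsilon>)
    moreover have "\<delta> j = 0" if "j \<notin> {1..k}" for j
      using that m \<epsilon>0[of m] by (cases "j = 0") (auto simp: \<delta>_def intro!: \<epsilon>(2))
    ultimately show ?thesis using \<tau> by (auto simp: colored_perms_def)
  qed
  ultimately show ?thesis using S card by blast
qed

section \<open>Counting by the position of the value 1\<close>

text \<open>Grafting is a bijection from pairs \<open>(S, v)\<close>, and \<open>S\<close> ranges
  over the \<open>k\<close>-subsets of the \<open>m + k - 1\<close> values other than 1. Leaving the
  predicate \<open>Q\<close> on the ascent set arbitrary serves both families.\<close>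

lemma card_zero_colored_descent_at:
  assumes m: "m \<ge> 1" and r: "r \<ge> 1"
  shows "card {w \<in> colored_perms (m + k) r. zero_colored_descent_at m w \<and> Q (Asc (m + k) w)}
       = (m + k - 1 choose k) * card {v \<in> colored_perms k r. Q (insert m ((+) m ` Asc k v))}"
proof -
  define \<S> where "\<S> = {S. S \<subseteq> {2..m + k} \<and> card S = k}"
  define P where "P S = (SOME p. shuffle m k S p)" for S
  have sh: "shuffle m k S (P S)" if "S \<in> \<S>" for S
  proof -
    have "\<exists>p. shuffle m k S p"
      by (rule exists_shuffle) (use that in \<open>auto simp: \<S>_def\<close>)
    thus ?thesis unfolding P_def by (rule someI_ex)
  qed
  have one: "1 \<notin> S" if "S \<in> \<S>" for S
    using that by (auto simp: \<S>_def)
  let ?f = "\<lambda>(S, v). graft m k (P S) v"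
  let ?A = "\<S> \<times> {v \<in> colored_perms k r. Q (insert m ((+) m ` Asc k v))}"
  let ?B = "{w \<in> colored_perms (m + k) r. zero_colored_descent_at m w \<and> Q (Asc (m + k) w)}"
  have inj: "inj_on ?f ?A"
    by (rule inj_on_subset[OF inj_on_graft[of \<S> m k P r]]) (auto intro: sh)
  have img: "?f ` ?A = ?B"
  proof (intro equalityI subsetI)
    fix w assume "w \<in> ?f ` ?A"
    then obtain S v where Sv: "S \<in> \<S>" "v \<in> colored_perms k r" "w = graft m k (P S) v"
        "Q (insert m ((+) m ` Asc k v))"
      by auto
    note facts = sh[OF Sv(1)] m one[OF Sv(1)] Sv(2)
    show "w \<in> ?B"
      using Sv r Asc_graft[OF facts] zero_colored_descent_at_graft[OF facts]
        graft_in_colored_perms[OF facts(1,2,4)] by simp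
  next
    fix w assume w: "w \<in> ?B"
    then obtain S v where Sv: "S \<in> \<S>" "v \<in> colored_perms k r" "w = graft m k (P S) v"
      using graft_surj[of w m k r P] m sh unfolding \<S>_def by blast
    hence "Q (insert m ((+) m ` Asc k v))"
      using w Asc_graft[OF sh[OF Sv(1)] m one[OF Sv(1)] Sv(2)] by simp
    thus "w \<in> ?f ` ?A" using Sv by (auto intro!: image_eqI[of _ _ "(S, v)"])
  qed
  have "card ?B = card ?A"
    using card_image[OF inj] unfolding img .
  also have "card ?A = card \<S> * card {v \<in> colored_perms k r. Q (insert m ((+) m ` Asc k v))}"
    by (rule card_cartesian_product)
  also have "card \<S> = (m + k - 1 choose k)"
    unfolding \<S>_def by (subst n_subsets) auto
  finally show ?thesis .
qed

lemma finite_colored_perms: "finite (colored_perms n r)"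
proof (rule finite_subset)
  show "colored_perms n r \<subseteq> {\<sigma>. \<sigma> permutes {1..n}} \<times>
      {\<epsilon>. \<forall>k. (k \<in> {1..n} \<longrightarrow> \<epsilon> k \<in> {..<r}) \<and> (k \<notin> {1..n} \<longrightarrow> \<epsilon> k = 0)}"
    by (auto simp: colored_perms_def)
  show "finite ({\<sigma>. \<sigma> permutes {1..n}} \<times>
      {\<epsilon>. \<forall>k. (k \<in> {1..n} \<longrightarrow> \<epsilon> k \<in> {..<r}) \<and> (k \<notin> {1..n} \<longrightarrow> \<epsilon> k = 0)})"
    by (intro finite_cartesian_product finite_permutations finite_set_of_finite_funs) auto
qed

text \<open>Indexing by the tail length \<open>k\<close> instead of the position
  \<open>m = n + 1 - k\<close> makes the binomial coefficient appear as
  \<open>n choose k\<close>.\<close>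

lemma zero_colored_descent_to_one_iff:
  "zero_colored_descent_to_one (n + 1) w \<longleftrightarrow> (\<exists>k\<in>{0..n}. zero_colored_descent_at (n + 1 - k) w)"
proof -
  have "zero_colored_descent_to_one (n + 1) w \<longleftrightarrow> (\<exists>m\<in>{1..n + 1}. zero_colored_descent_at m w)"
    by (cases w) (simp add: zero_colored_descent_to_one_def zero_colored_descent_at_def)
  also have "{1..n + 1} = (\<lambda>k. n + 1 - k) ` {0..n}"
  proof (intro equalityI subsetI)
    fix m assume "m \<in> {1..n + 1}"
    thus "m \<in> (\<lambda>k. n + 1 - k) ` {0..n}"
      by (intro image_eqI[of _ _ "n + 1 - m"]) auto
  qed auto
  finally show ?thesis by simp
qed

text \<open>The classes for different \<open>k\<close> are disjoint, because a permutation takes the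
  value 1 only once.\<close>

lemma card_zero_colored_descent_to_one:
  assumes "r \<ge> 1"
  shows "card {w \<in> colored_perms (n + 1) r. zero_colored_descent_to_one (n + 1) w \<and> Q (Asc (n + 1) w)}
       = (\<Sum>k = 0..n. (n choose k) *
            card {v \<in> colored_perms k r. Q (insert (n + 1 - k) ((+) (n + 1 - k) ` Asc k v))})"
proof -
  let ?F = "\<lambda>k. {w \<in> colored_perms (n + 1) r. zero_colored_descent_at (n + 1 - k) w \<and> Q (Asc (n + 1) w)}"
  have "{w \<in> colored_perms (n + 1) r. zero_colored_descent_to_one (n + 1) w \<and> Q (Asc (n + 1) w)}
      = (\<Union>k\<in>{0..n}. ?F k)"
    unfolding zero_colored_descent_to_one_iff by blast
  moreover have "card (\<Union>k\<in>{0..n}. ?F k) = (\<Sum>k\<in>{0..n}. card (?F k))"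
  proof (rule card_UN_disjoint)
    show "\<forall>k\<in>{0..n}. finite (?F k)"
      using finite_colored_perms by simp
    show "\<forall>k\<in>{0..n}. \<forall>k'\<in>{0..n}. k \<noteq> k' \<longrightarrow> ?F k \<inter> ?F k' = {}"
    proof (intro ballI impI equals0I)
      fix k k' w assume k: "k \<in> {0..n}" "k' \<in> {0..n}" "k \<noteq> k'" and w: "w \<in> ?F k \<inter> ?F k'"
      obtain \<sigma> \<epsilon> where "w = (\<sigma>, \<epsilon>)" by force
      with w have "\<sigma> permutes {1..n + 1}" "\<sigma> (n + 1 - k) = \<sigma> (n + 1 - k')"
        by (auto simp: colored_perms_def zero_colored_descent_at_def)
      hence "n + 1 - k = n + 1 - k'"
        by (metis permutes_inj injD)
      thus False using k by auto
    qed
  qed simp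
  moreover have "card (?F k) = (n choose k) *
      card {v \<in> colored_perms k r. Q (insert (n + 1 - k) ((+) (n + 1 - k) ` Asc k v))}"
    if "k \<in> {0..n}" for k
    using that assms card_zero_colored_descent_at[of "n + 1 - k" r k Q] by simp
  ultimately show ?thesis by simp
qed

section \<open>From conditions on the enlarged ascent set to the numbers xi\<close>

text \<open>The only new adjacency is between \<open>m\<close> and \<open>m + 1\<close>, and the
  latter lies in the shifted set exactly when \<open>1 \<in> A\<close>.\<close>

lemma no_two_consecutive_insert_shift:
  assumes "A \<subseteq> {1..k}"
  shows "no_two_consecutive (insert m ((+) m ` A)) \<longleftrightarrow> 1 \<notin> A \<and> no_two_consecutive A"
  using assms by (auto simp: no_two_consecutive_def image_iff)

lemma card_insert_shift:
  fixes A :: "nat set"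
  assumes "A \<subseteq> {1..k}"
  shows "card (insert m ((+) m ` A)) = Suc (card A)"
proof -
  have "finite A" using finite_subset[OF assms] by simp
  moreover have "m \<notin> (+) m ` A" using assms by auto
  ultimately show ?thesis by (simp add: card_image)
qed

text \<open>\<open>S\<close> and its translate by -1 are disjoint subsets of \<open>{1..b}\<close>
  of equal size.\<close>

lemma two_card_le_if_no_two_consecutive:
  assumes "S \<subseteq> {2..b}" "no_two_consecutive S"
  shows "2 * card S \<le> b"
proof -
  have fin: "finite S" using finite_subset[OF assms(1)] by simp
  have inj: "inj_on (\<lambda>x. x - 1) S"
    using assms by (intro inj_onI) (auto dest!: subsetD)
  have "S \<inter> (\<lambda>x. x - 1) ` S = {}"
  proof (rule equals0I)
    fix y assume "y \<in> S \<inter> (\<lambda>x. x - 1) ` S"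
    then obtain x where x: "x \<in> S" "x - 1 \<in> S" by auto
    moreover have "x \<ge> 2" using assms(1) x by auto
    ultimately show False using assms(2) bspec[of S _ "x - 1"] by (auto simp: no_two_consecutive_def)
  qed
  hence "2 * card S = card (S \<union> (\<lambda>x. x - 1) ` S)"
    using fin inj by (simp add: card_Un_disjoint card_image)
  also have "\<dots> \<le> card {1..b}"
  proof (rule card_mono)
    have "x - 1 \<in> {1..b}" "x \<in> {1..b}" if "x \<in> S" for x
      using subsetD[OF assms(1) that] by auto
    thus "S \<union> (\<lambda>x. x - 1) ` S \<subseteq> {1..b}" by blast
  qed simp
  finally show ?thesis by simp
qed

lemma Asc_subset_iff:
  "Asc k v \<subseteq> {2..k} \<longleftrightarrow> 1 \<notin> Asc k v"
  "k \<ge> 1 \<Longrightarrow> Asc k v \<subseteq> {2..k - 1} \<longleftrightarrow> 1 \<notin> Asc k v \<and> k \<notin> Asc k v"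
proof -
  have "x \<in> {2..k} \<longleftrightarrow> x \<noteq> 1" "k \<ge> 1 \<Longrightarrow> x \<in> {2..k - 1} \<longleftrightarrow> x \<noteq> 1 \<and> x \<noteq> k" if "x \<in> Asc k v" for x
    using subsetD[OF Asc_subset that] by auto
  thus "Asc k v \<subseteq> {2..k} \<longleftrightarrow> 1 \<notin> Asc k v"
    "k \<ge> 1 \<Longrightarrow> Asc k v \<subseteq> {2..k - 1} \<longleftrightarrow> 1 \<notin> Asc k v \<and> k \<notin> Asc k v"
    by blast+
qed

lemma colored_perms_0: "colored_perms 0 r = {(id, \<lambda>_. 0)}"
  by (auto simp: colored_perms_def)

lemma Asc_0 [simp]: "Asc 0 v = {}"
  by (simp add: Asc_def)

text \<open>The form of \<open>xi_plus\<close> that the counting formula produces: the inserted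
  \<open>m\<close> adds one ascent and forbids 1 as an ascent of \<open>v\<close>. For
  \<open>k = 0\<close> only \<open>{m}\<close> arises, which qualifies exactly when
  \<open>i = 0\<close>, in line with the convention.\<close>

lemma xi_plus_eq_card:
  "xi_plus k r i = card {v \<in> colored_perms k r.
     (let A = insert m ((+) m ` Asc k v)
      in card A = i + 1 \<and> no_two_consecutive A \<and> m + k \<in> A)}"
proof (cases "k = 0")
  case True
  thus ?thesis
    by (cases "i = 0") (simp_all add: xi_plus_def colored_perms_0 no_two_consecutive_def Let_def)
next
  case False
  have "(Asc k v \<subseteq> {2..k} \<and> card (Asc k v) = i \<and> no_two_consecutive (Asc k v) \<and> k \<in> Asc k v) \<longleftrightarrow>
     (let A = insert m ((+) m ` Asc k v)
      in card A = i + 1 \<and> no_two_consecutive A \<and> m + k \<in> A)" for v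
    using False card_insert_shift[OF Asc_subset[of k v], of m]
      no_two_consecutive_insert_shift[OF Asc_subset[of k v], of m]
    by (auto simp: Let_def Asc_subset_iff(1))
  thus ?thesis using False by (simp add: xi_plus_def)
qed

text \<open>Inserting \<open>m\<close> raises the number of ascents from \<open>i - 1\<close> to
  \<open>i\<close>, which removes the offset in \<open>xi_minus\<close>.\<close>

lemma xi_minus_eq_card:
  "xi_minus k r i = card {v \<in> colored_perms k r.
     (let A = insert m ((+) m ` Asc k v)
      in m + k \<notin> A \<and> card A = i \<and> no_two_consecutive A)}"
proof (cases "k = 0")
  case True
  \<comment> \<open>Here \<open>A = {m}\<close> contains \<open>m + k\<close>, so the set is empty,
    matching the convention for \<open>xi_minus 0 r i\<close>.\<close>
  thus ?thesis by (simp add: xi_minus_def Let_def)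
next
  case False
  have "(Asc k v \<subseteq> {2..k - 1} \<and> card (Asc k v) + 1 = i \<and> no_two_consecutive (Asc k v)) \<longleftrightarrow>
     (let A = insert m ((+) m ` Asc k v)
      in m + k \<notin> A \<and> card A = i \<and> no_two_consecutive A)" for v
    using False card_insert_shift[OF Asc_subset[of k v], of m]
      no_two_consecutive_insert_shift[OF Asc_subset[of k v], of m] Asc_subset_iff(2)[of k v]
    by (auto simp: Let_def)
  thus ?thesis using False by (simp add: xi_minus_def)
qed

text \<open>Allows the sum in \<open>gamma_tilde_plus\<close> to start at \<open>k = 0\<close>, as
  in the counting formula.\<close>

lemma xi_plus_eq_0:
  assumes "k < 2 * i"
  shows "xi_plus k r i = 0"
proof -
  have "\<not> (Asc k w \<subseteq> {2..k} \<and> card (Asc k w) = i \<and> no_two_consecutive (Asc k w))" for w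
    using assms two_card_le_if_no_two_consecutive[of "Asc k w" k] by auto
  hence "{w \<in> colored_perms k r. Asc k w \<subseteq> {2..k} \<and> card (Asc k w) = i \<and>
           no_two_consecutive (Asc k w) \<and> k \<in> Asc k w} = {}"
    by blast
  thus ?thesis using assms by (cases "k = 0") (simp_all only: xi_plus_def card.empty, simp_all)
qed

lemma xi_minus_eq_0:
  assumes "k < 2 * i - 1"
  shows "xi_minus k r i = 0"
proof -
  \<comment> \<open>The bound reads \<open>2 * (i - 1) \<le> k - 1\<close>. For \<open>k = 0\<close>
    the truncated \<open>k - 1\<close> would admit \<open>i = 1\<close>, so that case rests on the
    convention instead.\<close>
  have "\<not> (Asc k w \<subseteq> {2..k - 1} \<and> card (Asc k w) + 1 = i \<and> no_two_consecutive (Asc k w))"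
    if "k \<noteq> 0" for w
    using assms that two_card_le_if_no_two_consecutive[of "Asc k w" "k - 1"] by auto
  thus ?thesis by (cases "k = 0") (simp_all add: xi_minus_def card_eq_0_iff)
qed

section \<open>Combinatorial interpretation of the coefficients\<close>

lemma gamma_tilde_plus_eq_card:
  assumes "r \<ge> 1"
  shows "gamma_tilde_plus n r i = card (gamma_plus_family n r i)"
proof -
  let ?Q = "\<lambda>A. card A = i + 1 \<and> no_two_consecutive A \<and> n + 1 \<in> A"
  have "gamma_tilde_plus n r i = (\<Sum>k = 0..n. (n choose k) * xi_plus k r i)"
    unfolding gamma_tilde_plus_def by (rule sum.mono_neutral_left) (auto simp: xi_plus_eq_0)
  also have "\<dots> = (\<Sum>k = 0..n. (n choose k) *
      card {v \<in> colored_perms k r. ?Q (insert (n + 1 - k) ((+) (n + 1 - k) ` Asc k v))})"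
  proof (intro sum.cong refl)
    \<comment> \<open>The choice \<open>m = n + 1 - k\<close> makes \<open>m + k\<close> the last
      position \<open>n + 1\<close>.\<close>
    fix k assume "k \<in> {0..n}"
    thus "(n choose k) * xi_plus k r i = (n choose k) *
      card {v \<in> colored_perms k r. ?Q (insert (n + 1 - k) ((+) (n + 1 - k) ` Asc k v))}"
      by (subst xi_plus_eq_card[where m = "n + 1 - k"]) (simp add: Let_def)
  qed
  also have "\<dots> = card {w \<in> colored_perms (n + 1) r.
      zero_colored_descent_to_one (n + 1) w \<and> ?Q (Asc (n + 1) w)}"
    by (rule card_zero_colored_descent_to_one[OF assms, symmetric])
  also have "\<dots> = card (gamma_plus_family n r i)"
    unfolding gamma_plus_family_def by (rule arg_cong[of _ _ card]) blast
  finally show ?thesis .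
qed

lemma gamma_tilde_minus_eq_card:
  assumes "r \<ge> 1"
  shows "gamma_tilde_minus n r i = card (gamma_minus_family n r i)"
proof -
  let ?Q = "\<lambda>A. n + 1 \<notin> A \<and> card A = i \<and> no_two_consecutive A"
  have "gamma_tilde_minus n r i = (\<Sum>k = 0..n. (n choose k) * xi_minus k r i)"
    unfolding gamma_tilde_minus_def by (rule sum.mono_neutral_left) (auto simp: xi_minus_eq_0)
  also have "\<dots> = (\<Sum>k = 0..n. (n choose k) *
      card {v \<in> colored_perms k r. ?Q (insert (n + 1 - k) ((+) (n + 1 - k) ` Asc k v))})"
  proof (intro sum.cong refl)
    fix k assume "k \<in> {0..n}"
    thus "(n choose k) * xi_minus k r i = (n choose k) *
      card {v \<in> colored_perms k r. ?Q (insert (n + 1 - k) ((+) (n + 1 - k) ` Asc k v))}"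
      by (subst xi_minus_eq_card[where m = "n + 1 - k"]) (simp add: Let_def)
  qed
  also have "\<dots> = card {w \<in> colored_perms (n + 1) r.
      zero_colored_descent_to_one (n + 1) w \<and> ?Q (Asc (n + 1) w)}"
    by (rule card_zero_colored_descent_to_one[OF assms, symmetric])
  also have "\<dots> = card (gamma_minus_family n r i)"
  proof -
    have "Asc (n + 1) w \<subseteq> {1..n} \<longleftrightarrow> n + 1 \<notin> Asc (n + 1) w" for w
    proof -
      have "x \<in> {1..n} \<longleftrightarrow> x \<noteq> n + 1" if "x \<in> Asc (n + 1) w" for x
        using subsetD[OF Asc_subset that] by auto
      thus ?thesis by blast
    qed
    thus ?thesis
      unfolding gamma_minus_family_def by (intro arg_cong[of _ _ card]) blast
  qed
  finally show ?thesis .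
qed

theorem corollary3p3:
  fixes n r :: nat
  assumes "n \<ge> 1" and "r \<ge> 2"
  shows "A_tilde_plus n r =
           (\<Sum>i = 0..n div 2.
              of_nat (gamma_tilde_plus n r i) * tvar ^ i * (1 + tvar) ^ (n - 2 * i))
       \<and> A_tilde_minus n r =
           (\<Sum>i = 1..(n + 1) div 2.
              of_nat (gamma_tilde_minus n r i) * tvar ^ i * (1 + tvar) ^ (n + 1 - 2 * i))
       \<and> (\<forall>i. gamma_tilde_plus n r i = card (gamma_plus_family n r i))
       \<and> (\<forall>i. gamma_tilde_minus n r i = card (gamma_minus_family n r i))"
  using assms A_tilde_plus_expansion A_tilde_minus_expansion
    gamma_tilde_plus_eq_card gamma_tilde_minus_eq_card by simp

end
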